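(* Let $N\in\mathbb N$, let $\hat\rho_0\in\mathrm{Herm}(N)$ be positive semidefinite of full rank, and let $\tau>0$. For every $\hat\sigma\in\mathrm{Herm}(N)$, $$\partial\big(\widehat{\mathrm{QKL}}(\cdot,\hat\rho_0)\big)^*(\hat\sigma)=\{\exp(\hat\sigma+\ln\hat\rho_0)\}$$ and $$\operatorname{prox}_{\tau(\widehat{\mathrm{QKL}}(\cdot,\hat\rho_0))^*}(\hat\sigma)=\hat\sigma-W\big(\tau\exp(\hat\sigma+\ln\hat\rho_0)\big)=\hat\sigma-g^{-1}\big(\hat\sigma+\ln\hat\rho_0+\ln\tau\big).$$
   Context: $\mathrm{Herm}(N)$ is the real vector space of Hermitian $N\times N$ complex matrices with inner product $\langle\hat\sigma,\hat\rho\rangle=\operatorname{tr}(\hat\sigma\hat\rho)$ and norm $\|\hat\rho\|_2=\operatorname{tr}(\hat\rho^2)^{1/2}$; subdifferentials are taken with respect to this inner product. The quantum relative entropy $\widehat{\mathrm{QKL}}(\hat\rho,\hat\rho_0)$ (with $\hat\rho_0$ positive definite) equals $\operatorname{tr}(\hat\rho_0-\hat\rho+\hat\rho\ln\hat\rho-\hat\rho\ln\hat\rho_0)$ if $\hat\rho$ is positive semidefinite (with $0\ln0=0$ in the spectral calculus), and $+\infty$ otherwise. The conjugate of $F:\mathrm{Herm}(N)\to\mathbb R\cup\{\infty\}$ is $F^*(\hat\sigma)=\sup_{\hat\rho}\big(\operatorname{tr}(\hat\sigma\hat\rho)-F(\hat\rho)\big)$, and $\operatorname{prox}_{\tau F}(\hat\sigma)=\operatorname{argmin}_{\hat\rho\in\mathrm{Herm}(N)}F(\hat\rho)+\frac1{2\tau}\|\hat\rho-\hat\sigma\|_2^2$.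 The function $g:(0,\infty)\to\mathbb R$, $g(t)=\ln t+t$, is a bijection with inverse $g^{-1}(t)=W(e^t)$, where $W$ is the (principal branch of the) Lambert $W$ function; scalar functions are applied to Hermitian matrices by spectral calculus, and the scalar $\ln\tau$ stands for $(\ln\tau)$ times the identity matrix. *)

theory Defs
  imports "HOL-Analysis.Analysis"
begin

section \<open>Hermitian matrices\<close>

definition ctransp :: "complex^'n^'m \<Rightarrow> complex^'m^'n" where
  "ctransp A = map_matrix cnj (transpose A)"

definition Herm :: "(complex^'n^'n) set" where
  "Herm = {A. ctransp A = A}"

definition psd :: "complex^'n^'n \<Rightarrow> bool" where
  "psd A \<longleftrightarrow> A \<in> Herm \<and> (\<forall>x. 0 \<le> Re (\<Sum>i\<in>UNIV. cnj (x $ i) * (A *v x) $ i))"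

text \<open>The trace of a product of two Hermitian matrices is real, so \<open>Re\<close> only changes the type.\<close>

definition herm_inner :: "complex^'n^'n \<Rightarrow> complex^'n^'n \<Rightarrow> real" where
  "herm_inner A B = Re (trace (A ** B))"

definition herm_norm :: "complex^'n^'n \<Rightarrow> real" where
  "herm_norm A = sqrt (herm_inner A A)"

section \<open>Spectral calculus\<close>

definition unitary_mat :: "complex^'n^'n \<Rightarrow> bool" where
  "unitary_mat U \<longleftrightarrow> ctransp U ** U = mat 1 \<and> U ** ctransp U = mat 1"

definition real_diag :: "('n \<Rightarrow> real) \<Rightarrow> complex^'n^'n" where
  "real_diag d = (\<chi> i j. if i = j then complex_of_real (d i) else 0)"

text \<open>For a Hermitian matrix \<open>A\<close>, a decomposition \<open>A = U diag(d) U\<^sup>*\<close> exists by the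
  spectral theorem, and by \<open>spectral_eqI\<close> below the resulting matrix \<open>U diag(f d) U\<^sup>*\<close>
  does not depend on its choice.\<close>

definition spectral :: "(real \<Rightarrow> real) \<Rightarrow> complex^'n^'n \<Rightarrow> complex^'n^'n" where
  "spectral f A = (THE B. \<exists>U d. unitary_mat U \<and> A = U ** real_diag d ** ctransp U \<and>
                               B = U ** real_diag (f \<circ> d) ** ctransp U)"

lemma real_diag_mult_left: "(real_diag d ** Q) $ i $ j = complex_of_real (d i) * Q $ i $ j"
  by (simp add: real_diag_def matrix_matrix_mult_def if_distrib[of "\<lambda>x. x * _"] cong: if_cong)

lemma real_diag_mult_right: "(Q ** real_diag d) $ i $ j = Q $ i $ j * complex_of_real (d j)"
  by (simp add: real_diag_def matrix_matrix_mult_def if_distrib[of "\<lambda>x. _ * x"] cong: if_cong)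

lemma spectral_unique:
  assumes U: "unitary_mat U" and V: "unitary_mat V"
    and eq: "U ** real_diag d ** ctransp U = V ** real_diag e ** ctransp V"
  shows "U ** real_diag (f \<circ> d) ** ctransp U = V ** real_diag (f \<circ> e) ** ctransp V"
proof -
  define Q where "Q = ctransp V ** U"
  have *: "ctransp V ** (U ** D ** ctransp U) ** U = Q ** D" for D
    using U by (simp add: Q_def unitary_mat_def matrix_mul_assoc[symmetric])
  have **: "ctransp V ** (V ** D ** ctransp V) ** U = D ** Q" for D
    using V by (simp add: Q_def unitary_mat_def matrix_mul_assoc)
  have "Q ** real_diag d = real_diag e ** Q"
    by (metis * ** eq)
  then have "Q $ i $ j * complex_of_real (d j) = complex_of_real (e i) * Q $ i $ j" for i j
    by (metis real_diag_mult_left real_diag_mult_right)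
  then have "Q $ i $ j = 0 \<or> d j = e i" for i j
    by (metis mult.commute mult_cancel_left of_real_eq_iff)
  then have "Q $ i $ j * complex_of_real (f (d j)) = complex_of_real (f (e i)) * Q $ i $ j" for i j
    by (metis mult.commute mult_zero_left)
  then have "Q ** real_diag (f \<circ> d) = real_diag (f \<circ> e) ** Q"
    by (simp add: vec_eq_iff real_diag_mult_left real_diag_mult_right)
  then have "V ** (Q ** real_diag (f \<circ> d)) ** ctransp U = V ** (real_diag (f \<circ> e) ** Q) ** ctransp U"
    by simp
  moreover have "V ** (Q ** D) = U ** D" for D
    using V by (simp add: Q_def unitary_mat_def matrix_mul_assoc)
  moreover have "(D ** Q) ** ctransp U = D ** ctransp V" for D
    using U by (simp add: Q_def unitary_mat_def matrix_mul_assoc[symmetric])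
  ultimately show ?thesis
    by (metis matrix_mul_assoc)
qed

lemma spectral_eqI:
  assumes "unitary_mat U" and "A = U ** real_diag d ** ctransp U"
  shows "spectral f A = U ** real_diag (f \<circ> d) ** ctransp U"
  unfolding spectral_def using assms by (intro the_equality) (auto intro: spectral_unique)

section \<open>Convex analysis on Hermitian matrices\<close>

definition conjugate :: "(complex^'n^'n \<Rightarrow> ereal) \<Rightarrow> complex^'n^'n \<Rightarrow> ereal" where
  "conjugate F \<sigma> = (SUP \<rho>\<in>Herm. ereal (herm_inner \<sigma> \<rho>) - F \<rho>)"

text \<open>Points at which \<open>F\<close> is not finite have empty subdifferential.\<close>

definition subdifferential :: "(complex^'n^'n \<Rightarrow> ereal) \<Rightarrow> complex^'n^'n \<Rightarrow> (complex^'n^'n) set" where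
  "subdifferential F \<sigma> = {\<rho> \<in> Herm. \<bar>F \<sigma>\<bar> \<noteq> \<infinity> \<and>
     (\<forall>\<sigma>'\<in>Herm. F \<sigma> + ereal (herm_inner \<rho> (\<sigma>' - \<sigma>)) \<le> F \<sigma>')}"

text \<open>The proximal operator of \<open>\<tau> F\<close>, as the set of all minimisers.\<close>

definition prox :: "real \<Rightarrow> (complex^'n^'n \<Rightarrow> ereal) \<Rightarrow> complex^'n^'n \<Rightarrow> (complex^'n^'n) set" where
  "prox \<tau> F \<sigma> = {\<rho>. is_arg_min (\<lambda>\<rho>. F \<rho> + ereal (1 / (2 * \<tau>) * (herm_norm (\<rho> - \<sigma>))\<^sup>2))
                                (\<lambda>\<rho>. \<rho> \<in> Herm) \<rho>}"

section \<open>Quantum relative entropy and the Lambert function\<close>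

definition QKL :: "complex^'n^'n \<Rightarrow> complex^'n^'n \<Rightarrow> ereal" where
  "QKL \<rho> \<rho>\<^sub>0 = (if psd \<rho>
     then ereal (Re (trace (\<rho>\<^sub>0 - \<rho> + spectral (\<lambda>t. if t = 0 then 0 else t * ln t) \<rho>
                              - \<rho> ** spectral ln \<rho>\<^sub>0)))
     else \<infinity>)"

text \<open>The principal real branch; a genuine value exists for arguments at least \<open>- exp (- 1)\<close>.\<close>

definition lambert_W :: "real \<Rightarrow> real" where
  "lambert_W x = (THE w. - 1 \<le> w \<and> w * exp w = x)"

definition g_fun :: "real \<Rightarrow> real" where
  "g_fun t = ln t + t"

definition g_inv :: "real \<Rightarrow> real" where
  "g_inv = the_inv_into {0<..} g_fun"

end

theory Submission
  imports Defs
begin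

text \<open>The conjugate of the relative entropy is \<open>\<sigma> \<mapsto> tr (exp (\<sigma> + ln \<rho>\<^sub>0)) - tr \<rho>\<^sub>0\<close>: this is Klein's
  inequality \<open>tr (R ln R - R H - R + exp H) \<ge> 0\<close>, which in eigenbases of \<open>R\<close> and \<open>H\<close> is an average of
  its scalar version with the weights \<open>\<bar>\<langle>u\<^sub>i, v\<^sub>j\<rangle>\<bar>\<^sup>2\<close>. Its equality case identifies the
  subgradients, and no differentiability of the matrix exponential is needed. For
  \<open>\<rho> = \<sigma> - W (\<tau> exp (\<sigma> + ln \<rho>\<^sub>0))\<close> both \<open>\<rho> + ln \<rho>\<^sub>0\<close> and \<open>\<sigma> - \<rho>\<close> are functions of
  \<open>\<sigma> + ln \<rho>\<^sub>0\<close>, so that \<open>exp (\<rho> + ln \<rho>\<^sub>0) = (\<sigma> - \<rho>) / \<tau>\<close>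
  can be checked on eigenvalues; this is the optimality condition of the proximal problem.\<close>

section \<open>The spectral theorem\<close>

definition cinner :: "complex^'n \<Rightarrow> complex^'n \<Rightarrow> complex" where
  "cinner x y = (\<Sum>i\<in>UNIV. cnj (x $ i) * y $ i)"

lemma cinner_add_right: "cinner x (y + z) = cinner x y + cinner x z"
  by (simp add: cinner_def algebra_simps sum.distrib)

lemma cinner_diff_right: "cinner x (y - z) = cinner x y - cinner x z"
  by (simp add: cinner_def algebra_simps sum_subtractf)

lemma cinner_scaleR_right: "cinner x (c *\<^sub>R y) = complex_of_real c * cinner x y"
  by (simp add: cinner_def scaleR_conv_of_real[where 'a=complex] sum_distrib_left mult_ac)

lemma cinner_scaleR_left: "cinner (c *\<^sub>R x) y = complex_of_real c * cinner x y"
  by (simp add: cinner_def scaleR_conv_of_real[where 'a=complex] sum_distrib_left mult_ac)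

lemma cnj_cinner: "cnj (cinner x y) = cinner y x"
  by (simp add: cinner_def mult.commute)

lemma of_real_cmod_power2: "(complex_of_real (cmod z))\<^sup>2 = z * cnj z"
  by (metis complex_norm_square of_real_power)

lemma cinner_self: "cinner x x = complex_of_real ((norm x)\<^sup>2)"
proof -
  have "cinner x x = complex_of_real (x \<bullet> x)"
    by (simp add: cinner_def inner_vec_def of_real_cmod_power2 mult.commute flip: power2_norm_eq_inner)
  then show ?thesis
    by (simp add: power2_norm_eq_inner)
qed

text \<open>Links the complex inner product, which expresses orthogonality, to the real one of the
  vector type, in which the Rayleigh quotient is written.\<close>

lemma inner_eq_Re_cinner: "x \<bullet> y = Re (cinner x y)"
  by (simp add: cinner_def inner_vec_def inner_complex_def)

lemma continuous_on_cinner_right: "continuous_on S (cinner x)"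
  unfolding cinner_def by (intro continuous_intros)

lemma ctransp_nth: "ctransp A $ i $ j = cnj (A $ j $ i)"
  by (simp add: ctransp_def map_matrix_def transpose_def)

lemma Herm_nth: "A \<in> Herm \<Longrightarrow> cnj (A $ i $ j) = A $ j $ i"
  unfolding Herm_def by (metis (mono_tags) ctransp_nth mem_Collect_eq)

lemma HermI: "(\<And>i j. cnj (A $ i $ j) = A $ j $ i) \<Longrightarrow> A \<in> Herm"
  by (simp add: Herm_def vec_eq_iff ctransp_nth)

lemma cinner_Herm:
  assumes "A \<in> Herm"
  shows "cinner (A *v x) y = cinner x (A *v y)"
proof -
  have "cinner (A *v x) y = (\<Sum>i\<in>UNIV. \<Sum>j\<in>UNIV. A $ j $ i * cnj (x $ j) * y $ i)"
    by (simp add: cinner_def matrix_vector_mult_def sum_distrib_right Herm_nth[OF assms])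
  also have "\<dots> = (\<Sum>j\<in>UNIV. \<Sum>i\<in>UNIV. A $ j $ i * cnj (x $ j) * y $ i)"
    by (rule sum.swap)
  also have "\<dots> = cinner x (A *v y)"
    by (simp add: cinner_def matrix_vector_mult_def sum_distrib_left mult_ac)
  finally show ?thesis .
qed

lemma matrix_vector_scaleR: "(A::complex^'n^'m) *v (c *\<^sub>R x) = c *\<^sub>R (A *v x)"
  by (simp add: vec_eq_iff matrix_vector_mult_def scaleR_sum_right)

text \<open>The orthogonality conditions are rows of a square linear system. Since \<open>k\<close>
  is outside \<open>S\<close>, row \<open>k\<close> is zero, so the system is singular and has a
  nonzero solution.\<close>

lemma exists_orthogonal:
  fixes v :: "'n \<Rightarrow> complex^'n"
  assumes "k \<notin> S"
  obtains x where "x \<noteq> 0" and "\<forall>i\<in>S. cinner (v i) x = 0"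
proof -
  define M :: "complex^'n^'n" where "M = (\<chi> i j. if i \<in> S then cnj (v i $ j) else 0)"
  have "row k M = 0"
    using assms by (simp add: M_def row_def vec_eq_iff)
  then have "\<not> invertible M"
    by (simp add: invertible_det_nz det_zero_row)
  then obtain x where x: "x \<noteq> 0" "M *v x = 0"
    unfolding invertible_left_inverse matrix_left_invertible_ker by blast
  have "cinner (v i) x = 0" if "i \<in> S" for i
  proof -
    have "(M *v x) $ i = cinner (v i) x"
      using that by (simp add: M_def matrix_vector_mult_def cinner_def)
    then show ?thesis using x by simp
  qed
  with x that show thesis by blast
qed

text \<open>A maximiser of the Rayleigh quotient on the orthogonal complement of the eigenvectors
  found so far is a further eigenvector.\<close>

lemma eigenvector_orthogonal:
  fixes v :: "'n \<Rightarrow> complex^'n"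
  assumes A: "A \<in> Herm" and k: "k \<notin> S"
    and ev: "\<forall>i\<in>S. A *v v i = d i *\<^sub>R v i"
  obtains x c where "norm x = 1" and "\<forall>i\<in>S. cinner (v i) x = 0" and "A *v x = c *\<^sub>R x"
proof -
  define W where "W = {x. \<forall>i\<in>S. cinner (v i) x = 0}"
  define q where "q x = x \<bullet> (A *v x)" for x
  have W_add: "x + y \<in> W" if "x \<in> W" "y \<in> W" for x y
    using that by (simp add: W_def cinner_add_right)
  have W_diff: "x - y \<in> W" if "x \<in> W" "y \<in> W" for x y
    using that by (simp add: W_def cinner_diff_right)
  have W_scale: "c *\<^sub>R x \<in> W" if "x \<in> W" for x c
    using that by (simp add: W_def cinner_scaleR_right)
  \<comment> \<open>Moving \<open>A\<close> to the other side of \<open>cinner\<close> lets it act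
    on the eigenvectors \<open>v i\<close>, which it only scales, so \<open>W\<close> is invariant
    under \<open>A\<close>.\<close>
  have W_A: "A *v x \<in> W" if "x \<in> W" for x
    using that ev by (simp add: W_def cinner_Herm[OF A, symmetric] cinner_scaleR_left)
  have sym: "x \<bullet> (A *v y) = y \<bullet> (A *v x)" for x y
    by (metis cinner_Herm[OF A] inner_commute inner_eq_Re_cinner)
  have W_eq: "W = (\<Inter>i\<in>S. {x. cinner (v i) x = 0})"
    by (auto simp: W_def)
  have "closed W"
    unfolding W_eq
    by (intro closed_INT ballI closed_Collect_eq continuous_on_cinner_right continuous_intros)
  then have compact: "compact (W \<inter> sphere 0 1)"
    by (simp add: closed_Int_compact)
  obtain z where z: "z \<noteq> 0" "\<forall>i\<in>S. cinner (v i) z = 0"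
    using exists_orthogonal[OF k] by blast
  then have "(1 / norm z) *\<^sub>R z \<in> W \<inter> sphere 0 1"
    using W_scale by (simp add: W_def cinner_scaleR_right)
  then have nonempty: "W \<inter> sphere 0 1 \<noteq> {}"
    by blast
  have "continuous_on (W \<inter> sphere 0 1) q"
    unfolding q_def matrix_vector_mult_def by (intro continuous_intros)
  then obtain x where x: "x \<in> W" "norm x = 1"
    and max: "\<And>y. y \<in> W \<Longrightarrow> norm y = 1 \<Longrightarrow> q y \<le> q x"
    using continuous_attains_sup[OF compact nonempty, of q] by (metis IntD1 IntD2 IntI mem_sphere_0)
  have q_scale: "q (c *\<^sub>R y) = c\<^sup>2 * q y" for c y
    by (simp add: q_def matrix_vector_scaleR power2_eq_square)
  \<comment> \<open>Both sides scale quadratically, so maximality on the unit sphere extends to all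
    of \<open>W\<close>.\<close>
  have le: "q y \<le> q x * (y \<bullet> y)" if "y \<in> W" for y
  proof (cases "y = 0")
    case False
    then have "q ((1 / norm y) *\<^sub>R y) \<le> q x"
      using that by (intro max W_scale) auto
    then have "q y / (norm y)\<^sup>2 \<le> q x"
      by (simp add: q_scale power_divide)
    then show ?thesis
      using False by (simp add: divide_le_eq power2_norm_eq_inner)
  qed (simp add: q_def)
  \<comment> \<open>The residual of the eigenvalue equation for the maximiser \<open>x\<close>; it
    serves as a direction of variation and turns out to be zero.\<close>
  define r where "r = A *v x - q x *\<^sub>R x"
  have r: "r \<in> W"
    unfolding r_def using x by (intro W_diff W_A W_scale)
  have rr: "r \<bullet> (A *v x) - q x * (x \<bullet> r) = r \<bullet> r"
    by (metis inner_commute inner_diff_right inner_scaleR_right r_def)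
  define C where "C = q x * (r \<bullet> r) - q r"
  \<comment> \<open>Inserting \<open>x + t *\<^sub>R r\<close> into \<open>le\<close> cancels the
    terms of order zero. The first-order term is \<open>2 * t * (r \<bullet> r)\<close>, the
    second-order terms are collected in \<open>C\<close>, and one factor \<open>t\<close> is divided
    out. Letting \<open>t\<close> tend to 0 then forces \<open>r = 0\<close>.\<close>
  have bound: "2 * (r \<bullet> r) \<le> t * C" if "t > 0" for t
  proof -
    have "q (x + t *\<^sub>R r) = q x + 2 * t * (r \<bullet> (A *v x)) + t\<^sup>2 * q r"
      using sym[of x r] unfolding q_def
      by (simp add: matrix_vector_right_distrib matrix_vector_scaleR inner_add_left inner_add_right
          power2_eq_square algebra_simps)
    moreover have "(x + t *\<^sub>R r) \<bullet> (x + t *\<^sub>R r) = 1 + 2 * t * (x \<bullet> r) + t\<^sup>2 * (r \<bullet> r)"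
      using x(2) norm_eq_1[of x] by (simp add: inner_add_left inner_add_right inner_commute[of r x]
          power2_eq_square algebra_simps del: norm_eq_1)
    moreover have "q (x + t *\<^sub>R r) \<le> q x * ((x + t *\<^sub>R r) \<bullet> (x + t *\<^sub>R r))"
      by (intro le W_add W_scale x r)
    ultimately have "2 * t * (r \<bullet> (A *v x) - q x * (x \<bullet> r)) \<le> t\<^sup>2 * C"
      by (simp add: C_def algebra_simps)
    then have "t * (2 * (r \<bullet> r)) \<le> t * (t * C)"
      by (simp add: rr power2_eq_square mult_ac)
    then show ?thesis
      using that by (simp only: mult_le_cancel_left_pos)
  qed
  have "((\<lambda>t. t * C) \<longlongrightarrow> 0 * C) (at_right 0)"
    by (intro tendsto_intros)
  then have "2 * (r \<bullet> r) \<le> 0 * C"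
    by (rule tendsto_lowerbound) (auto simp: eventually_at_right_less bound eventually_at_filter)
  then have "r = 0"
    using inner_gt_zero_iff[of r] by linarith
  then have "A *v x = q x *\<^sub>R x"
    by (simp add: r_def)
  with x that show thesis
    by (auto simp: W_def)
qed

text \<open>Allowing an arbitrary index set \<open>S\<close> makes induction possible, one new
  eigenvector per index; \<open>S = UNIV\<close> gives a full orthonormal eigenbasis.\<close>

lemma orthonormal_eigenvectors:
  fixes A :: "complex^'n^'n" and S :: "'n set"
  assumes A: "A \<in> Herm"
  shows "\<exists>v d. (\<forall>i\<in>S. A *v v i = d i *\<^sub>R v i) \<and> (\<forall>i\<in>S. \<forall>j\<in>S. cinner (v i) (v j) = of_bool (i = j))"
  using finite[of S]
proof (induction S rule: finite_induct)
  case (insert k S)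
  then obtain v d where v: "\<forall>i\<in>S. A *v v i = d i *\<^sub>R v i"
      "\<forall>i\<in>S. \<forall>j\<in>S. cinner (v i) (v j) = of_bool (i = j)"
    by blast
  obtain x c where x: "norm x = 1" "\<forall>i\<in>S. cinner (v i) x = 0" "A *v x = c *\<^sub>R x"
    using eigenvector_orthogonal[OF A insert.hyps(2) v(1)] by blast
  have "\<forall>i\<in>S. cinner x (v i) = 0"
    using x(2) by (metis cnj_cinner complex_cnj_zero)
  with v x insert.hyps(2)
  have "(\<forall>i\<in>insert k S. A *v (v(k := x)) i = (d(k := c)) i *\<^sub>R (v(k := x)) i) \<and>
     (\<forall>i\<in>insert k S. \<forall>j\<in>insert k S. cinner ((v(k := x)) i) ((v(k := x)) j) = of_bool (i = j))"
    by (auto simp: cinner_self)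
  then show ?case by blast
qed simp

abbreviation udiag :: "complex^'n^'n \<Rightarrow> ('n \<Rightarrow> real) \<Rightarrow> complex^'n^'n" where
  "udiag U d \<equiv> U ** real_diag d ** ctransp U"

theorem spectral_theorem:
  fixes A :: "complex^'n^'n"
  assumes "A \<in> Herm"
  obtains U d where "unitary_mat U" and "A = udiag U d"
proof -
  obtain v :: "'n \<Rightarrow> complex^'n" and d where v: "\<And>i. A *v v i = d i *\<^sub>R v i"
      "\<And>i j. cinner (v i) (v j) = of_bool (i = j)"
    using orthonormal_eigenvectors[OF assms, of UNIV] by (metis UNIV_I)
  \<comment> \<open>With eigenvectors as columns, orthonormality becomes
    \<open>ctransp U ** U = mat 1\<close>; for square matrices the other product is then the
    identity as well.\<close>
  define U where "U = (\<chi> i j. v j $ i)"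
  have "ctransp U ** U = mat 1"
    using v(2) by (simp add: vec_eq_iff matrix_matrix_mult_def ctransp_nth U_def cinner_def mat_def)
  then have U: "unitary_mat U"
    by (simp add: unitary_mat_def matrix_left_right_inverse)
  have "(A ** U) $ i $ j = (A *v v j) $ i" for i j
    by (simp add: matrix_matrix_mult_def matrix_vector_mult_def U_def)
  then have "A ** U = U ** real_diag d"
    using v(1) by (simp add: vec_eq_iff real_diag_mult_right U_def scaleR_conv_of_real[where 'a=complex] mult.commute)
  then have "udiag U d = A ** (U ** ctransp U)"
    by (simp add: matrix_mul_assoc)
  then have "A = udiag U d"
    using U by (simp add: unitary_mat_def)
  then show thesis
    by (rule that[OF U])
qed

section \<open>Traces and the Hilbert--Schmidt inner product\<close>

lemma Re_trace_diff: "Re (trace (A - B)) = Re (trace A) - Re (trace B)"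
  by (simp add: trace_sub)

lemma Re_trace_add: "Re (trace (A + B)) = Re (trace A) + Re (trace B)"
  by (simp add: trace_add)

text \<open>The Hermitian symmetry of \<open>B\<close> turns the trace form into the Euclidean inner
  product of the matrix type, so that the usual norm identities apply in the proximal
  problem.\<close>

lemma herm_inner_eq_inner:
  assumes "B \<in> Herm"
  shows "herm_inner A B = A \<bullet> B"
proof -
  have "Re (A $ i $ j * B $ j $ i) = A $ i $ j \<bullet> B $ i $ j" for i j
    by (simp add: Herm_nth[OF assms, of i j, symmetric] inner_complex_def)
  then show ?thesis
    by (simp add: herm_inner_def trace_def matrix_matrix_mult_def inner_vec_def)
qed

lemma herm_norm_eq_norm: "A \<in> Herm \<Longrightarrow> herm_norm A = norm A"
  by (simp add: herm_norm_def herm_inner_eq_inner norm_eq_sqrt_inner)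

section \<open>Hermitian matrices with a common eigenbasis\<close>

lemma Herm_add: "A \<in> Herm \<Longrightarrow> B \<in> Herm \<Longrightarrow> A + B \<in> Herm"
  by (intro HermI) (simp add: Herm_nth)

lemma Herm_diff: "A \<in> Herm \<Longrightarrow> B \<in> Herm \<Longrightarrow> A - B \<in> Herm"
  by (intro HermI) (simp add: Herm_nth)

lemma udiag_nth: "udiag U d $ i $ j = (\<Sum>k\<in>UNIV. complex_of_real (d k) * (U $ i $ k * cnj (U $ j $ k)))"
  by (simp add: matrix_matrix_mult_def[of "U ** real_diag d"] real_diag_mult_right ctransp_nth mult_ac)

lemma udiag_Herm: "udiag U d \<in> Herm"
  by (intro HermI) (simp add: udiag_nth mult_ac)

lemma udiag_add: "udiag U d + udiag U e = udiag U (\<lambda>i. d i + e i)"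
  by (simp add: vec_eq_iff udiag_nth algebra_simps sum.distrib)

lemma udiag_diff: "udiag U d - udiag U e = udiag U (\<lambda>i. d i - e i)"
  by (simp add: vec_eq_iff udiag_nth algebra_simps sum_subtractf)

lemma udiag_scaleR: "c *\<^sub>R udiag U d = udiag U (\<lambda>i. c * d i)"
  by (simp add: vec_eq_iff udiag_nth scaleR_sum_right scaleR_conv_of_real[where 'a=complex] sum_distrib_left mult_ac)

lemma udiag_const:
  assumes "unitary_mat U"
  shows "udiag U (\<lambda>_. c) = mat (complex_of_real c)"
proof -
  have "udiag U (\<lambda>_. c) = c *\<^sub>R (U ** ctransp U)"
    by (simp add: vec_eq_iff udiag_nth matrix_matrix_mult_def[of U "ctransp U"] ctransp_nth
        sum_distrib_left scaleR_conv_of_real[where 'a=complex])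
  also have "\<dots> = mat (complex_of_real c)"
    using assms by (simp add: unitary_mat_def vec_eq_iff mat_def scaleR_conv_of_real[where 'a=complex])
  finally show ?thesis .
qed

section \<open>Overlaps of two eigenbases\<close>

lemma unitary_mat_ctransp_mult:
  assumes "unitary_mat U" "unitary_mat V"
  shows "unitary_mat (ctransp V ** U)"
proof -
  have "ctransp (ctransp V ** U) = ctransp U ** V"
    by (simp add: vec_eq_iff ctransp_nth matrix_matrix_mult_def mult.commute)
  then show ?thesis
    using assms unfolding unitary_mat_def
    by (metis matrix_mul_assoc matrix_mul_lid)
qed

lemma unitary_mat_col_sum:
  assumes "unitary_mat Q"
  shows "(\<Sum>j\<in>UNIV. (cmod (Q $ j $ i))\<^sup>2) = 1"
proof -
  have "(ctransp Q ** Q) $ i $ i = complex_of_real (\<Sum>j\<in>UNIV. (cmod (Q $ j $ i))\<^sup>2)"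
    by (simp add: matrix_matrix_mult_def ctransp_nth of_real_cmod_power2 mult.commute)
  then show ?thesis
    using assms by (simp add: unitary_mat_def mat_def flip: of_real_eq_1_iff[where 'a=complex])
qed

lemma unitary_mat_row_sum:
  assumes "unitary_mat Q"
  shows "(\<Sum>i\<in>UNIV. (cmod (Q $ j $ i))\<^sup>2) = 1"
proof -
  have "(Q ** ctransp Q) $ j $ j = complex_of_real (\<Sum>i\<in>UNIV. (cmod (Q $ j $ i))\<^sup>2)"
    by (simp add: matrix_matrix_mult_def ctransp_nth of_real_cmod_power2)
  then show ?thesis
    using assms by (simp add: unitary_mat_def mat_def flip: of_real_eq_1_iff[where 'a=complex])
qed

text \<open>Cyclicity of the trace gathers both bases in the overlap matrix
  \<open>ctransp V ** U\<close>, whose entries are the inner products of the eigenvectors; their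
  squared moduli remain as weights.\<close>

lemma trace_udiag_mult_udiag:
  "trace (udiag U p ** udiag V h) =
     complex_of_real (\<Sum>i\<in>UNIV. \<Sum>j\<in>UNIV. (cmod ((ctransp V ** U) $ j $ i))\<^sup>2 * (p i * h j))"
proof -
  define Q where "Q = ctransp V ** U"
  have Q': "ctransp Q = ctransp U ** V"
    by (simp add: Q_def vec_eq_iff ctransp_nth matrix_matrix_mult_def mult.commute)
  have "trace (udiag U p ** udiag V h) = trace ((U ** (real_diag p ** ctransp Q ** real_diag h)) ** ctransp V)"
    by (simp add: Q' matrix_mul_assoc)
  also have "\<dots> = trace (ctransp V ** (U ** (real_diag p ** ctransp Q ** real_diag h)))"
    by (rule trace_mul_sym)
  also have "\<dots> = trace (Q ** (real_diag p ** ctransp Q ** real_diag h))"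
    by (simp add: Q_def matrix_mul_assoc)
  also have "\<dots> = (\<Sum>j\<in>UNIV. \<Sum>i\<in>UNIV. complex_of_real ((cmod (Q $ j $ i))\<^sup>2 * (p i * h j)))"
    by (simp add: trace_def matrix_matrix_mult_def[of Q] real_diag_mult_left real_diag_mult_right
        ctransp_nth of_real_cmod_power2 mult_ac)
  also have "\<dots> = (\<Sum>i\<in>UNIV. \<Sum>j\<in>UNIV. complex_of_real ((cmod (Q $ j $ i))\<^sup>2 * (p i * h j)))"
    by (rule sum.swap)
  finally show ?thesis
    by (simp add: Q_def)
qed

lemma herm_inner_udiag:
  "herm_inner (udiag U p) (udiag V h) =
     (\<Sum>i\<in>UNIV. \<Sum>j\<in>UNIV. (cmod ((ctransp V ** U) $ j $ i))\<^sup>2 * (p i * h j))"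
  by (simp only: herm_inner_def trace_udiag_mult_udiag Re_complex_of_real)

lemma herm_inner_udiag_same:
  fixes U :: "complex^'n^'n"
  assumes "unitary_mat U"
  shows "herm_inner (udiag U p) (udiag U h) = (\<Sum>i\<in>UNIV. p i * h i)"
proof -
  have "ctransp U ** U = mat 1"
    using assms by (simp add: unitary_mat_def)
  moreover have "(cmod ((mat 1 :: complex^'n^'n) $ j $ i))\<^sup>2 * x = (if i = j then x else 0)" for i j x
    by (simp add: mat_def)
  ultimately show ?thesis
    by (simp add: herm_inner_udiag)
qed

lemma trace_udiag:
  assumes "unitary_mat U"
  shows "trace (udiag U p) = complex_of_real (\<Sum>i\<in>UNIV. p i)"
proof -
  have "trace (udiag U p) = trace (ctransp U ** (U ** real_diag p))"
    by (rule trace_mul_sym)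
  also have "\<dots> = trace (real_diag p)"
    using assms by (simp add: matrix_mul_assoc unitary_mat_def)
  finally show ?thesis
    by (simp add: trace_def real_diag_def)
qed

section \<open>Positive semidefiniteness in terms of eigenvalues\<close>

lemma quadratic_form_udiag:
  "(\<Sum>i\<in>UNIV. cnj (x $ i) * (udiag U p *v x) $ i) =
     complex_of_real (\<Sum>k\<in>UNIV. p k * (cmod ((ctransp U *v x) $ k))\<^sup>2)"
proof -
  have "(\<Sum>i\<in>UNIV. cnj (x $ i) * (udiag U p *v x) $ i) =
     (\<Sum>i\<in>UNIV. \<Sum>j\<in>UNIV. \<Sum>k\<in>UNIV. p k * (cnj (x $ i) * U $ i $ k * (cnj (U $ j $ k) * x $ j)))"
    by (simp add: matrix_vector_mult_def udiag_nth sum_distrib_left sum_distrib_right mult_ac)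
  also have "\<dots> = (\<Sum>i\<in>UNIV. \<Sum>k\<in>UNIV. \<Sum>j\<in>UNIV. p k * (cnj (x $ i) * U $ i $ k * (cnj (U $ j $ k) * x $ j)))"
    by (intro sum.cong refl sum.swap)
  also have "\<dots> = (\<Sum>k\<in>UNIV. \<Sum>i\<in>UNIV. \<Sum>j\<in>UNIV. p k * (cnj (x $ i) * U $ i $ k * (cnj (U $ j $ k) * x $ j)))"
    by (rule sum.swap)
  also have "\<dots> = (\<Sum>k\<in>UNIV. p k * (cnj ((ctransp U *v x) $ k) * (ctransp U *v x) $ k))"
    by (simp add: matrix_vector_mult_def ctransp_nth sum_product sum_distrib_left mult_ac)
  finally show ?thesis
    by (simp add: of_real_cmod_power2 mult_ac)
qed

lemma psd_udiag_iff:
  assumes U: "unitary_mat U"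
  shows "psd (udiag U p) \<longleftrightarrow> (\<forall>i. 0 \<le> p i)"
proof
  assume psd: "psd (udiag U p)"
  show "\<forall>i. 0 \<le> p i"
  proof
    fix i
    \<comment> \<open>Column \<open>i\<close> of \<open>U\<close>, an eigenvector, at which the
      quadratic form equals \<open>p i\<close>.\<close>
    define x where "x = U *v axis i 1"
    have "ctransp U *v x = axis i 1"
      using U by (simp add: x_def matrix_vector_mul_assoc unitary_mat_def)
    then have "(\<Sum>k\<in>UNIV. p k * (cmod ((ctransp U *v x) $ k))\<^sup>2) = (\<Sum>k\<in>UNIV. if k = i then p k else 0)"
      by (intro sum.cong) (auto simp: axis_def)
    moreover have "0 \<le> (\<Sum>k\<in>UNIV. p k * (cmod ((ctransp U *v x) $ k))\<^sup>2)"
      using psd unfolding psd_def quadratic_form_udiag by simp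
    ultimately show "0 \<le> p i"
      by simp
  qed
next
  assume "\<forall>i. 0 \<le> p i"
  then show "psd (udiag U p)"
    unfolding psd_def quadratic_form_udiag by (simp add: udiag_Herm sum_nonneg)
qed

lemma spectral_udiag: "unitary_mat U \<Longrightarrow> spectral f (udiag U d) = udiag U (\<lambda>i. f (d i))"
  using spectral_eqI[of U "udiag U d" d f] by (simp add: comp_def)

lemma spectral_Herm:
  assumes "A \<in> Herm"
  shows "spectral f A \<in> Herm"
proof -
  obtain U d where "unitary_mat U" "A = udiag U d"
    using spectral_theorem[OF assms] .
  then show ?thesis
    by (simp add: spectral_udiag udiag_Herm)
qed

section \<open>Klein's inequality\<close>

text \<open>For \<open>p = 0\<close> only \<open>exp h > 0\<close> is left. For \<open>p > 0\<close>
  and \<open>u = exp h / p\<close> the expression is \<open>p * (u - 1 - ln u)\<close>, and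
  \<open>ln u \<le> u - 1\<close> holds with equality only at \<open>u = 1\<close>.\<close>

lemma scalar_klein:
  fixes p h :: real
  assumes "0 \<le> p"
  shows "0 \<le> p * ln p - p * h - p + exp h"
    and "p * ln p - p * h - p + exp h = 0 \<Longrightarrow> p = exp h"
proof -
  have "0 \<le> p * ln p - p * h - p + exp h \<and> (p * ln p - p * h - p + exp h = 0 \<longrightarrow> p = exp h)"
  proof (cases "p = 0")
    case False
    with assms have p: "p > 0" by simp
    define u where "u = exp h / p"
    have u: "u > 0" "exp h = p * u" "h = ln p + ln u"
      using p by (simp_all add: u_def ln_div)
    have "p * ln p - p * h - p + exp h = p * (u - 1 - ln u)"
      by (simp add: u(2)) (simp add: u(3) algebra_simps)
    moreover have "ln u \<le> u - 1"
      using u by (simp add: ln_le_minus_one)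
    moreover have "ln u = u - 1 \<Longrightarrow> u = 1"
      using u by (simp add: ln_eq_minus_one)
    ultimately show ?thesis
      using p u(2) by auto
  qed auto
  then show "0 \<le> p * ln p - p * h - p + exp h"
    and "p * ln p - p * h - p + exp h = 0 \<Longrightarrow> p = exp h"
    by auto
qed

text \<open>The squared moduli of the entries of a unitary matrix are doubly stochastic weights, so
  each single sum can be spread over both indices without changing its value.\<close>

lemma klein_expansion:
  assumes U: "unitary_mat U" and V: "unitary_mat V"
  shows "(\<Sum>i\<in>UNIV. a i) - herm_inner (udiag U p) (udiag V h) + (\<Sum>j\<in>UNIV. b j) =
    (\<Sum>i\<in>UNIV. \<Sum>j\<in>UNIV. (cmod ((ctransp V ** U) $ j $ i))\<^sup>2 * (a i - p i * h j + b j))"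
proof -
  define w where "w i j = (cmod ((ctransp V ** U) $ j $ i))\<^sup>2" for i j
  note Q = unitary_mat_ctransp_mult[OF U V]
  have row: "(\<Sum>j\<in>UNIV. w i j) = 1" and col: "(\<Sum>i\<in>UNIV. w i j) = 1" for i j
    unfolding w_def by (rule unitary_mat_col_sum[OF Q] unitary_mat_row_sum[OF Q])+
  have "(\<Sum>i\<in>UNIV. \<Sum>j\<in>UNIV. w i j * a i) = (\<Sum>i\<in>UNIV. a i)"
    by (simp add: row flip: sum_distrib_right)
  moreover have "(\<Sum>i\<in>UNIV. \<Sum>j\<in>UNIV. w i j * b j) = (\<Sum>j\<in>UNIV. b j)"
    by (subst sum.swap) (simp add: col flip: sum_distrib_right)
  moreover have "(\<Sum>i\<in>UNIV. \<Sum>j\<in>UNIV. w i j * (a i - p i * h j + b j)) =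
     (\<Sum>i\<in>UNIV. \<Sum>j\<in>UNIV. w i j * a i) - (\<Sum>i\<in>UNIV. \<Sum>j\<in>UNIV. w i j * (p i * h j))
       + (\<Sum>i\<in>UNIV. \<Sum>j\<in>UNIV. w i j * b j)"
    by (simp add: algebra_simps sum.distrib sum_subtractf)
  ultimately show ?thesis
    by (simp add: herm_inner_udiag w_def)
qed

lemma klein:
  assumes U: "unitary_mat U" and V: "unitary_mat V" and p: "\<And>i. 0 \<le> p i"
  shows "0 \<le> (\<Sum>i\<in>UNIV. p i * ln (p i) - p i) - herm_inner (udiag U p) (udiag V h) + (\<Sum>j\<in>UNIV. exp (h j))"
  unfolding klein_expansion[OF U V]
proof (intro sum_nonneg mult_nonneg_nonneg)
  show "0 \<le> p i * ln (p i) - p i - p i * h j + exp (h j)" for i j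
    using scalar_klein(1)[OF p, of i "h j"] by linarith
qed simp

lemma klein_eq:
  assumes U: "unitary_mat U" and V: "unitary_mat V" and p: "\<And>i. 0 \<le> p i"
    and le: "(\<Sum>i\<in>UNIV. p i * ln (p i) - p i) - herm_inner (udiag U p) (udiag V h) + (\<Sum>j\<in>UNIV. exp (h j)) \<le> 0"
  shows "udiag U p = udiag V (\<lambda>j. exp (h j))"
proof -
  define Q where "Q = ctransp V ** U"
  define t where "t i j = (cmod (Q $ j $ i))\<^sup>2 * (p i * ln (p i) - p i - p i * h j + exp (h j))" for i j
  have nonneg: "0 \<le> t i j" for i j
    using scalar_klein(1)[OF p, of i "h j"] by (simp add: t_def)
  have "(\<Sum>i\<in>UNIV. \<Sum>j\<in>UNIV. t i j) \<le> 0"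
    using le unfolding klein_expansion[OF U V] t_def Q_def .
  then have "(\<Sum>i\<in>UNIV. \<Sum>j\<in>UNIV. t i j) = 0"
    by (intro antisym sum_nonneg nonneg)
  then have t0: "t i j = 0" for i j
    by (simp add: sum_nonneg_eq_0_iff sum_nonneg nonneg)
  \<comment> \<open>Where the weight is nonzero, the equality case of the scalar inequality applies.
    Hence \<open>Q\<close> intertwines the two diagonal matrices, and returning to the original
    bases identifies the Hermitian ones.\<close>
  have "Q $ j $ i = 0 \<or> p i = exp (h j)" for i j
  proof -
    have "Q $ j $ i = 0 \<or> p i * ln (p i) - p i * h j - p i + exp (h j) = 0"
      using t0[of i j] by (auto simp: t_def)
    then show ?thesis
      using scalar_klein(2)[OF p, of i "h j"] by blast
  qed
  then have "Q $ j $ i * complex_of_real (p i) = complex_of_real (exp (h j)) * Q $ j $ i" for i j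
    by (metis mult.commute mult_zero_left)
  then have "Q ** real_diag p = real_diag (\<lambda>j. exp (h j)) ** Q"
    by (simp add: vec_eq_iff real_diag_mult_left real_diag_mult_right)
  then have "V ** (Q ** real_diag p) ** ctransp U = V ** (real_diag (\<lambda>j. exp (h j)) ** Q) ** ctransp U"
    by simp
  moreover have "V ** (Q ** real_diag p) ** ctransp U = udiag U p"
    using V by (simp add: Q_def unitary_mat_def matrix_mul_assoc)
  moreover have "(D ** Q) ** ctransp U = D ** ctransp V" for D
    using U by (simp add: Q_def unitary_mat_def matrix_mul_assoc[symmetric])
  ultimately show ?thesis
    by (metis matrix_mul_assoc)
qed

section \<open>The conjugate of the relative entropy\<close>

lemma QKL_udiag:
  assumes U: "unitary_mat U" and \<rho>\<^sub>0: "\<rho>\<^sub>0 \<in> Herm" and p: "\<And>i. 0 \<le> p i"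
  shows "QKL (udiag U p) \<rho>\<^sub>0 = ereal (Re (trace \<rho>\<^sub>0) + (\<Sum>i\<in>UNIV. p i * ln (p i) - p i)
    - herm_inner (udiag U p) (spectral ln \<rho>\<^sub>0))"
proof -
  have "psd (udiag U p)"
    using p by (simp add: psd_udiag_iff[OF U])
  \<comment> \<open>At a zero eigenvalue the factor \<open>p i\<close> makes the product 0 whatever
    value \<open>ln 0\<close> has, so the case distinction disappears.\<close>
  moreover have "spectral (\<lambda>t. if t = 0 then 0 else t * ln t) (udiag U p) = udiag U (\<lambda>i. p i * ln (p i))"
    by (simp add: spectral_udiag[OF U] if_distrib[of "\<lambda>x. _ * x"] cong: if_cong)
      (intro arg_cong[where f="udiag U"] ext, simp)
  ultimately show ?thesis
    by (simp add: QKL_def Re_trace_add Re_trace_diff trace_udiag[OF U] herm_inner_def sum_subtractf)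
qed

lemma herm_inner_commute:
  fixes A B :: "complex^'n^'n"
  shows "herm_inner A B = herm_inner B A"
  unfolding herm_inner_def by (subst trace_mul_sym) (rule refl)

lemma herm_inner_add_right: "herm_inner A (B + C) = herm_inner A B + herm_inner A C"
  by (simp add: herm_inner_def matrix_add_ldistrib trace_add)

lemma herm_inner_diff_right: "herm_inner A (B - C) = herm_inner A B - herm_inner A C"
  using herm_inner_add_right[of A "B - C" C] by simp

lemma conjugate_QKL:
  fixes \<rho>\<^sub>0 \<sigma> :: "complex^'n^'n"
  assumes \<rho>\<^sub>0: "\<rho>\<^sub>0 \<in> Herm" and \<sigma>: "\<sigma> \<in> Herm"
  shows "conjugate (\<lambda>\<rho>. QKL \<rho> \<rho>\<^sub>0) \<sigma> =
    ereal (Re (trace (spectral exp (\<sigma> + spectral ln \<rho>\<^sub>0))) - Re (trace \<rho>\<^sub>0))"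
    (is "_ = ereal ?G")
proof -
  obtain V h where V: "unitary_mat V" and h: "\<sigma> + spectral ln \<rho>\<^sub>0 = udiag V h"
    using spectral_theorem[OF Herm_add[OF \<sigma> spectral_Herm[OF \<rho>\<^sub>0]]] .
  have G: "?G = (\<Sum>j\<in>UNIV. exp (h j)) - Re (trace \<rho>\<^sub>0)"
    by (simp add: h spectral_udiag[OF V] trace_udiag[OF V])
  \<comment> \<open>The pairings with \<open>\<sigma>\<close> and with
    \<open>spectral ln \<rho>\<^sub>0\<close> merge into one with their sum,
    \<open>udiag V h\<close>; up to constants the objective is the negative of Klein's
    expression.\<close>
  have eq: "ereal (herm_inner \<sigma> (udiag U p)) - QKL (udiag U p) \<rho>\<^sub>0 =
      ereal (herm_inner (udiag U p) (udiag V h) - (\<Sum>i\<in>UNIV. p i * ln (p i) - p i) - Re (trace \<rho>\<^sub>0))"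
    if "unitary_mat U" "\<And>i. 0 \<le> p i" for U p
    using that herm_inner_add_right[of "udiag U p" \<sigma> "spectral ln \<rho>\<^sub>0"] h
    by (simp add: QKL_udiag \<rho>\<^sub>0 herm_inner_commute[of \<sigma>])
  show ?thesis
    unfolding conjugate_def
  proof (intro antisym SUP_least)
    fix \<rho> :: "complex^'n^'n"
    assume "\<rho> \<in> Herm"
    then obtain U p where U: "unitary_mat U" and \<rho>: "\<rho> = udiag U p"
      using spectral_theorem by blast
    show "ereal (herm_inner \<sigma> \<rho>) - QKL \<rho> \<rho>\<^sub>0 \<le> ereal ?G"
    proof (cases "psd \<rho>")
      case True
      then have p: "\<And>i. 0 \<le> p i"
        by (simp add: \<rho> psd_udiag_iff[OF U])
      then show ?thesis
        using klein[OF U V, of p h] p unfolding \<rho> eq[OF U p] G by simp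
    qed (simp add: QKL_def)
  next
    \<comment> \<open>The supremum is attained at the exponential of \<open>udiag V h\<close>, the
      equality case of Klein's inequality.\<close>
    have "ereal ?G = ereal (herm_inner \<sigma> (udiag V (\<lambda>j. exp (h j)))) - QKL (udiag V (\<lambda>j. exp (h j))) \<rho>\<^sub>0"
      unfolding G by (simp add: eq[OF V] herm_inner_udiag_same[OF V] sum_subtractf)
    also have "\<dots> \<le> (SUP \<rho>\<in>Herm. ereal (herm_inner \<sigma> \<rho>) - QKL \<rho> \<rho>\<^sub>0)"
      by (intro SUP_upper udiag_Herm)
    finally show "ereal ?G \<le> (SUP \<rho>\<in>Herm. ereal (herm_inner \<sigma> \<rho>) - QKL \<rho> \<rho>\<^sub>0)" .
  qed
qed

section \<open>Subgradients of the trace of the exponential\<close>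

lemma trace_exp_subgradient:
  assumes "A \<in> Herm" and "B \<in> Herm"
  shows "Re (trace (spectral exp A)) + herm_inner (spectral exp A) (B - A) \<le> Re (trace (spectral exp B))"
proof -
  obtain U a where U: "unitary_mat U" "A = udiag U a"
    using spectral_theorem[OF assms(1)] .
  obtain V b where V: "unitary_mat V" "B = udiag V b"
    using spectral_theorem[OF assms(2)] .
  \<comment> \<open>Klein's inequality is applied to \<open>spectral exp A\<close> and
    \<open>B\<close>: since \<open>ln (p i) = a i\<close>, its entropy term cancels the pairing of
    \<open>spectral exp A\<close> with \<open>A\<close>.\<close>
  define p where "p = (\<lambda>i. exp (a i))"
  have E: "spectral exp A = udiag U p"
    by (simp add: U spectral_udiag p_def)
  have "herm_inner (udiag U p) A = (\<Sum>i\<in>UNIV. p i * a i)"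
    unfolding U(2) by (rule herm_inner_udiag_same[OF U(1)])
  moreover have "0 \<le> (\<Sum>i\<in>UNIV. p i * ln (p i) - p i) - herm_inner (udiag U p) B + (\<Sum>j\<in>UNIV. exp (b j))"
    unfolding V(2) by (rule klein[OF U(1) V(1)]) (simp add: p_def)
  moreover have "Re (trace (spectral exp A)) = (\<Sum>i\<in>UNIV. p i)"
    unfolding E by (simp add: trace_udiag[OF U(1)])
  moreover have "Re (trace (spectral exp B)) = (\<Sum>j\<in>UNIV. exp (b j))"
    by (simp add: V spectral_udiag trace_udiag)
  ultimately show ?thesis
    unfolding E herm_inner_diff_right by (simp add: p_def sum_subtractf)
qed

text \<open>Uniqueness of the subgradient \<open>R\<close> is tested at \<open>B = ln R\<close>, where Klein's inequality
  is an equality. Eigenvalues of \<open>R\<close> that are not positive force a limiting argument: there \<open>B\<close>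
  gets the eigenvalue \<open>- s\<close> and \<open>s\<close> tends to infinity.\<close>

lemma trace_exp_subgradient_unique:
  fixes A R :: "complex^'n^'n"
  assumes A: "A \<in> Herm" and R: "R \<in> Herm"
    and sub: "\<And>B. B \<in> Herm \<Longrightarrow> Re (trace (spectral exp A)) + herm_inner R (B - A) \<le> Re (trace (spectral exp B))"
  shows "R = spectral exp A"
proof -
  obtain V h where V: "unitary_mat V" "A = udiag V h"
    using spectral_theorem[OF A] .
  obtain U p where U: "unitary_mat U" "R = udiag U p"
    using spectral_theorem[OF R] .
  \<comment> \<open>Test matrices diagonal in the eigenbasis of \<open>R\<close> reduce the
    subgradient inequality to one between eigenvalues.\<close>
  have sub': "(\<Sum>j\<in>UNIV. exp (h j)) + (\<Sum>i\<in>UNIV. p i * b i) - herm_inner R A \<le> (\<Sum>i\<in>UNIV. exp (b i))" for b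
  proof -
    have "herm_inner R (udiag U b) = (\<Sum>i\<in>UNIV. p i * b i)"
      unfolding U(2) by (rule herm_inner_udiag_same[OF U(1)])
    then show ?thesis
      using sub[OF udiag_Herm[of U b]]
      by (simp add: herm_inner_diff_right spectral_udiag[OF U(1)] trace_udiag[OF U(1)])
        (simp add: V(2) spectral_udiag[OF V(1)] trace_udiag[OF V(1)])
  qed
  define b where "b s i = (if p i > 0 then ln (p i) else - s)" for s :: real and i
  define c where "c = herm_inner R A - (\<Sum>j\<in>UNIV. exp (h j))"
  have le: "(\<Sum>i\<in>UNIV. p i * b s i - exp (b s i)) \<le> c" for s
    using sub'[of "b s"] by (simp add: c_def sum_subtractf)
  have p: "0 \<le> p i" for i
  proof (rule ccontr)
    assume neg: "\<not> 0 \<le> p i"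
    \<comment> \<open>A lower bound for each summand that does not depend on \<open>s\<close>; for
      \<open>p k \<le> 0\<close> it uses \<open>exp (- s) \<le> 1\<close>.\<close>
    define a where "a i = (if p i > 0 then p i * ln (p i) - p i else - 1)" for i
    have a_le: "a k \<le> p k * b s k - exp (b s k)" if "s \<ge> 0" for s k
    proof (cases "p k > 0")
      case False
      then have "0 \<le> - (p k * s)"
        using that by (simp add: mult_nonpos_nonneg)
      moreover have "exp (- s) \<le> 1"
        using that by simp
      ultimately have "- 1 \<le> - (p k * s) - exp (- s)"
        by linarith
      then show ?thesis
        using False by (simp add: a_def b_def)
    qed (simp add: a_def b_def)
    \<comment> \<open>The negative eigenvalue \<open>p i\<close> adds \<open>- (p i * s)\<close> to
      the lower bound. This grows linearly in \<open>s\<close>, while \<open>le\<close> keeps the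
      sum below \<open>c\<close>.\<close>
    have bound: "- (p i * s) \<le> c - (\<Sum>k\<in>UNIV. a k)" if s: "s \<ge> 0" for s
    proof -
      have "(\<Sum>k\<in>UNIV. a k + (if k = i then - (p i * s) else 0)) \<le> (\<Sum>k\<in>UNIV. p k * b s k - exp (b s k))"
      proof (rule sum_mono)
        fix k
        show "a k + (if k = i then - (p i * s) else 0) \<le> p k * b s k - exp (b s k)"
          using a_le[OF s, of k] neg s by (auto simp: a_def b_def)
      qed
      then show ?thesis
        using le[of s] by (simp add: sum.distrib)
    qed
    \<comment> \<open>This value of \<open>s\<close> makes the left side
      \<open>\<bar>c - (\<Sum>k\<in>UNIV. a k)\<bar> + 1\<close>, which exceeds the right
      side.\<close>
    have "- (p i * ((\<bar>c - (\<Sum>k\<in>UNIV. a k)\<bar> + 1) / - p i)) \<le> c - (\<Sum>k\<in>UNIV. a k)"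
      using neg by (intro bound divide_nonneg_nonneg) auto
    then show False
      using neg by auto
  qed
  \<comment> \<open>Only zero eigenvalues remain besides the positive ones; their contributions
    \<open>- exp (- s)\<close> vanish in the limit, which leaves the equality case of Klein's
    inequality.\<close>
  have "((\<lambda>s. \<Sum>i\<in>UNIV. if p i > 0 then p i * ln (p i) - p i else - exp (- s)) \<longlongrightarrow>
      (\<Sum>i\<in>UNIV. if p i > 0 then p i * ln (p i) - p i else - 0)) at_top"
    by (intro tendsto_sum) (auto intro!: tendsto_minus[where a=0, simplified]
        filterlim_compose[OF exp_at_bot] filterlim_uminus_at_bot_at_top)
  moreover have "(\<Sum>i\<in>UNIV. if p i > 0 then p i * ln (p i) - p i else - exp (- s)) \<le> c" for s
  proof -
    have "(if p i > 0 then p i * ln (p i) - p i else - exp (- s)) = p i * b s i - exp (b s i)" for i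
      using p[of i] by (auto simp: b_def)
    then show ?thesis
      using le[of s] by simp
  qed
  ultimately have "(\<Sum>i\<in>UNIV. if p i > 0 then p i * ln (p i) - p i else - 0) \<le> c"
    by (intro tendsto_upperbound) (auto intro: always_eventually)
  also have "(\<Sum>i\<in>UNIV. if p i > 0 then p i * ln (p i) - p i else - 0) = (\<Sum>i\<in>UNIV. p i * ln (p i) - p i)"
    using p by (intro sum.cong) (auto simp: not_less intro: antisym)
  finally have "(\<Sum>i\<in>UNIV. p i * ln (p i) - p i) - herm_inner R A + (\<Sum>j\<in>UNIV. exp (h j)) \<le> 0"
    by (simp add: c_def)
  then show ?thesis
    using klein_eq[OF U(1) V(1) p] by (simp add: U(2) V spectral_udiag)
qed

section \<open>The subdifferential of the conjugate\<close>

lemma subdifferential_conjugate_QKL: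
  fixes \<rho>\<^sub>0 \<sigma> :: "complex^'n^'n"
  assumes \<rho>\<^sub>0: "\<rho>\<^sub>0 \<in> Herm" and \<sigma>: "\<sigma> \<in> Herm"
  shows "subdifferential (conjugate (\<lambda>\<rho>. QKL \<rho> \<rho>\<^sub>0)) \<sigma> = {spectral exp (\<sigma> + spectral ln \<rho>\<^sub>0)}"
proof -
  define L where "L = spectral ln \<rho>\<^sub>0"
  have L: "L \<in> Herm"
    unfolding L_def by (rule spectral_Herm[OF \<rho>\<^sub>0])
  have conj: "conjugate (\<lambda>\<rho>. QKL \<rho> \<rho>\<^sub>0) \<sigma>' =
      ereal (Re (trace (spectral exp (\<sigma>' + L))) - Re (trace \<rho>\<^sub>0))" if "\<sigma>' \<in> Herm" for \<sigma>'
    using conjugate_QKL[OF \<rho>\<^sub>0 that] by (simp add: L_def)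
  have sub_iff: "R \<in> subdifferential (conjugate (\<lambda>\<rho>. QKL \<rho> \<rho>\<^sub>0)) \<sigma> \<longleftrightarrow> R \<in> Herm \<and>
      (\<forall>\<sigma>'\<in>Herm. Re (trace (spectral exp (\<sigma> + L))) + herm_inner R (\<sigma>' - \<sigma>)
         \<le> Re (trace (spectral exp (\<sigma>' + L))))" for R
    by (auto simp: subdifferential_def conj \<sigma>)
  show ?thesis
    unfolding L_def[symmetric]
  proof (intro set_eqI iffI)
    fix R
    assume "R \<in> subdifferential (conjugate (\<lambda>\<rho>. QKL \<rho> \<rho>\<^sub>0)) \<sigma>"
    then have R: "R \<in> Herm" and sub: "\<And>\<sigma>'. \<sigma>' \<in> Herm \<Longrightarrow> Re (trace (spectral exp (\<sigma> + L))) + herm_inner R (\<sigma>' - \<sigma>)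
         \<le> Re (trace (spectral exp (\<sigma>' + L)))"
      by (auto simp: sub_iff)
    \<comment> \<open>The conjugate is, up to a constant, the trace of the exponential translated by
      \<open>L\<close>, so the test point \<open>B\<close> corresponds to
      \<open>B - L\<close>.\<close>
    have "R = spectral exp (\<sigma> + L)"
    proof (rule trace_exp_subgradient_unique[OF Herm_add[OF \<sigma> L] R])
      fix B :: "complex^'n^'n"
      assume "B \<in> Herm"
      then show "Re (trace (spectral exp (\<sigma> + L))) + herm_inner R (B - (\<sigma> + L)) \<le> Re (trace (spectral exp B))"
        using sub[of "B - L"] L by (simp add: Herm_diff diff_diff_eq add.commute[of L])
    qed
    then show "R \<in> {spectral exp (\<sigma> + L)}"
      by simp
  next
    fix R
    assume "R \<in> {spectral exp (\<sigma> + L)}"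
    moreover have "Re (trace (spectral exp (\<sigma> + L))) + herm_inner (spectral exp (\<sigma> + L)) (\<sigma>' - \<sigma>)
         \<le> Re (trace (spectral exp (\<sigma>' + L)))" if "\<sigma>' \<in> Herm" for \<sigma>'
      using trace_exp_subgradient[OF Herm_add[OF \<sigma> L] Herm_add[OF that L]] by simp
    ultimately show "R \<in> subdifferential (conjugate (\<lambda>\<rho>. QKL \<rho> \<rho>\<^sub>0)) \<sigma>"
      by (simp add: sub_iff spectral_Herm Herm_add \<sigma> L)
  qed
qed

section \<open>The proximal operator\<close>

text \<open>The quadratic term is strongly convex, so it leaves the surplus
  \<open>1 / (2 * \<tau>) * (norm (R - \<rho>))\<^sup>2\<close> at a competitor \<open>R\<close>.\<close>

lemma prox_eqI:
  assumes \<tau>: "\<tau> > 0" and \<sigma>: "\<sigma> \<in> Herm" and \<rho>: "\<rho> \<in> Herm"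
    and sub: "(1 / \<tau>) *\<^sub>R (\<sigma> - \<rho>) \<in> subdifferential F \<rho>"
  shows "prox \<tau> F \<sigma> = {\<rho>}"
proof -
  define \<Phi> where "\<Phi> R = F R + ereal (1 / (2 * \<tau>) * (herm_norm (R - \<sigma>))\<^sup>2)" for R
  obtain f where f: "F \<rho> = ereal f"
    using sub by (auto simp: subdifferential_def)
  have surplus: "\<Phi> \<rho> + ereal (1 / (2 * \<tau>) * (norm (R - \<rho>))\<^sup>2) \<le> \<Phi> R" if R: "R \<in> Herm" for R
  proof -
    have "F \<rho> + ereal (herm_inner ((1 / \<tau>) *\<^sub>R (\<sigma> - \<rho>)) (R - \<rho>)) \<le> F R"
      using sub R by (simp add: subdifferential_def)
    then have le: "ereal (f + 1 / \<tau> * ((\<sigma> - \<rho>) \<bullet> (R - \<rho>))) \<le> F R"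
      by (simp add: f herm_inner_eq_inner Herm_diff R \<rho>)
    \<comment> \<open>Expansion of \<open>R - \<sigma> = (R - \<rho>) - (\<sigma> - \<rho>)\<close>.
      After scaling by \<open>1 / (2 * \<tau>)\<close> its cross term cancels the linear term of the
      subgradient inequality.\<close>
    have "(norm (R - \<sigma>))\<^sup>2 = (norm (\<rho> - \<sigma>))\<^sup>2 + (norm (R - \<rho>))\<^sup>2 - 2 * ((\<sigma> - \<rho>) \<bullet> (R - \<rho>))"
      by (simp add: power2_norm_eq_inner inner_diff_left inner_diff_right inner_commute)
    then have "1 / (2 * \<tau>) * (norm (\<rho> - \<sigma>))\<^sup>2 + 1 / (2 * \<tau>) * (norm (R - \<rho>))\<^sup>2
        = 1 / \<tau> * ((\<sigma> - \<rho>) \<bullet> (R - \<rho>)) + 1 / (2 * \<tau>) * (norm (R - \<sigma>))\<^sup>2"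
      using \<tau> by (simp add: field_simps)
    then have "\<Phi> \<rho> + ereal (1 / (2 * \<tau>) * (norm (R - \<rho>))\<^sup>2) =
        ereal (f + 1 / \<tau> * ((\<sigma> - \<rho>) \<bullet> (R - \<rho>))) + ereal (1 / (2 * \<tau>) * (norm (R - \<sigma>))\<^sup>2)"
      by (simp add: \<Phi>_def f herm_norm_eq_norm Herm_diff \<sigma> \<rho>)
    also have "\<dots> \<le> \<Phi> R"
      unfolding \<Phi>_def herm_norm_eq_norm[OF Herm_diff[OF R \<sigma>]] using le by (rule add_right_mono)
    finally show ?thesis .
  qed
  \<comment> \<open>Finiteness allows \<open>\<Phi> \<rho>\<close> to be cancelled in the extended
    reals when uniqueness is shown.\<close>
  have fin: "\<bar>\<Phi> \<rho>\<bar> \<noteq> \<infinity>"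
    by (simp add: \<Phi>_def f)
  have min: "\<Phi> \<rho> \<le> \<Phi> R" if "R \<in> Herm" for R
    by (rule order_trans[OF _ surplus[OF that]]) (use \<tau> in \<open>simp add: add_increasing2\<close>)
  have unique: "R = \<rho>" if R: "R \<in> Herm" "\<not> \<Phi> \<rho> < \<Phi> R" for R
  proof -
    have "\<Phi> \<rho> + ereal (1 / (2 * \<tau>) * (norm (R - \<rho>))\<^sup>2) \<le> \<Phi> \<rho>"
      using surplus[OF R(1)] R(2) by (meson not_less order_trans)
    then have "1 / (2 * \<tau>) * (norm (R - \<rho>))\<^sup>2 \<le> 0"
      using fin by (cases "\<Phi> \<rho>") auto
    then show ?thesis
      using \<tau> by (simp add: divide_le_0_iff)
  qed
  show ?thesis
    unfolding prox_def \<Phi>_def[symmetric] is_arg_min_def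
    using min unique \<rho> by (force simp: not_less)
qed

section \<open>The scalar equation \<open>t + ln t = y\<close> and its inverse functions\<close>

lemma exists_add_ln_eq:
  fixes y :: real
  obtains t where "t > 0" and "t + ln t = y"
proof -
  \<comment> \<open>Endpoints for the intermediate value theorem:
    \<open>ln a = - \<bar>y\<bar> - 1\<close> and \<open>a \<le> 1\<close> give
    \<open>a + ln a \<le> y\<close>, while \<open>ln b \<ge> 0\<close> gives
    \<open>y \<le> b + ln b\<close>.\<close>
  define a where "a = exp (- \<bar>y\<bar> - 1)"
  define b where "b = 1 + \<bar>y\<bar>"
  have a: "a > 0" "a \<le> 1" and b: "b \<ge> 1"
    by (simp_all add: a_def b_def)
  have "\<exists>t\<ge>a. t \<le> b \<and> t + ln t = y"
  proof (rule IVT')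
    show "a + ln a \<le> y"
      using a(2) by (simp only: a_def ln_exp)
    have "ln b \<ge> 0"
      using b by simp
    then show "y \<le> b + ln b"
      unfolding b_def by linarith
    show "a \<le> b"
      using a b by simp
    show "continuous_on {a..b} (\<lambda>t. t + ln t)"
      using a by (intro continuous_intros) auto
  qed
  then obtain t where "a \<le> t" "t + ln t = y"
    by blast
  with a that[of t] show thesis
    by simp
qed

text \<open>A competing solution has a positive product with its exponential, hence is positive, and
  \<open>w * exp w\<close> is strictly increasing on the positive reals.\<close>

lemma lambert_W_eq:
  assumes "t > 0"
  shows "lambert_W (t * exp t) = t"
  unfolding lambert_W_def
proof (rule the_equality)
  fix w :: real
  assume w: "- 1 \<le> w \<and> w * exp w = t * exp t"
  then have "w > 0"
    using assms by (metis exp_gt_zero zero_less_mult_pos2 mult_pos_pos)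
  show "w = t"
  proof (rule ccontr)
    assume "w \<noteq> t"
    then consider "w < t" | "t < w" by linarith
    then show False
    proof cases
      case 1
      then have "w * exp w < t * exp t"
        using \<open>w > 0\<close> by (intro mult_strict_mono) auto
      then show False using w by simp
    next
      case 2
      then have "t * exp t < w * exp w"
        using assms by (intro mult_strict_mono) auto
      then show False using w by simp
    qed
  qed
qed (use assms in simp)

lemma g_inv_eq:
  assumes "t > 0"
  shows "g_inv (ln t + t) = t"
proof -
  have "inj_on g_fun {0<..}"
  proof (rule linorder_inj_onI)
    fix x y :: real
    assume "x < y" "x \<in> {0<..}" "y \<in> {0<..}"
    then have "ln x < ln y"
      by simp
    with \<open>x < y\<close> show "g_fun x \<noteq> g_fun y"
      by (simp add: g_fun_def)
  qed auto
  from the_inv_into_f_f[OF this, of t] show ?thesis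
    using assms by (simp add: g_inv_def g_fun_def)
qed

theorem lemma3p4:
  fixes \<rho>\<^sub>0 \<sigma> :: "complex^'n^'n" and \<tau> :: real
  assumes "psd \<rho>\<^sub>0" and "rank \<rho>\<^sub>0 = CARD('n)"
    and "\<tau> > 0"
    and "\<sigma> \<in> Herm"
  shows "subdifferential (conjugate (\<lambda>\<rho>. QKL \<rho> \<rho>\<^sub>0)) \<sigma> = {spectral exp (\<sigma> + spectral ln \<rho>\<^sub>0)}
    \<and> prox \<tau> (conjugate (\<lambda>\<rho>. QKL \<rho> \<rho>\<^sub>0)) \<sigma> =
           {\<sigma> - spectral lambert_W (\<tau> *\<^sub>R spectral exp (\<sigma> + spectral ln \<rho>\<^sub>0))}
    \<and> \<sigma> - spectral lambert_W (\<tau> *\<^sub>R spectral exp (\<sigma> + spectral ln \<rho>\<^sub>0)) =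
           \<sigma> - spectral g_inv (\<sigma> + spectral ln \<rho>\<^sub>0 + mat (complex_of_real (ln \<tau>)))"
proof -
  define L where "L = spectral ln \<rho>\<^sub>0"
  have \<rho>\<^sub>0: "\<rho>\<^sub>0 \<in> Herm"
    using assms(1) by (simp add: psd_def)
  then have L: "L \<in> Herm"
    unfolding L_def by (rule spectral_Herm)
  obtain V h where V: "unitary_mat V" and h: "\<sigma> + L = udiag V h"
    using spectral_theorem[OF Herm_add[OF assms(4) L]] .
  \<comment> \<open>The solutions \<open>w j\<close> are the common eigenvalues of both matrices
    subtracted from \<open>\<sigma>\<close>: the equation is that of \<open>g_inv\<close>, and its
    exponential is that of \<open>lambert_W\<close>.\<close>
  have "\<exists>t>0. t + ln t = h j + ln \<tau>" for j
    using exists_add_ln_eq by metis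
  then obtain w where w: "\<And>j. w j > 0" and w_ln: "\<And>j. w j + ln (w j) = h j + ln \<tau>"
    by metis
  have exp_h: "\<tau> * exp (h j) = w j * exp (w j)" for j
  proof -
    have "\<tau> * exp (h j) = exp (h j + ln \<tau>)"
      using assms(3) by (simp add: exp_add)
    also have "\<dots> = w j * exp (w j)"
      by (simp add: w exp_add flip: w_ln)
    finally show ?thesis .
  qed
  have W: "spectral lambert_W (\<tau> *\<^sub>R spectral exp (\<sigma> + L)) = udiag V w"
    by (simp add: h spectral_udiag[OF V] udiag_scaleR exp_h lambert_W_eq w)
  have "\<sigma> + L + mat (complex_of_real (ln \<tau>)) = udiag V (\<lambda>j. ln (w j) + w j)"
    by (simp add: h udiag_add flip: udiag_const[OF V] w_ln) (simp add: add.commute)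
  then have G: "spectral g_inv (\<sigma> + L + mat (complex_of_real (ln \<tau>))) = udiag V w"
    by (simp add: spectral_udiag[OF V] g_inv_eq w)
  have \<rho>: "\<sigma> - udiag V w \<in> Herm"
    by (intro Herm_diff assms udiag_Herm)
  \<comment> \<open>Dividing \<open>exp_h\<close> by \<open>\<tau> * exp (w j)\<close> gives the
    optimality condition for each eigenvalue.\<close>
  have "exp (h j - w j) = 1 / \<tau> * w j" for j
    using exp_h[of j] assms(3) by (simp add: exp_diff field_simps)
  moreover have "\<sigma> - udiag V w + L = udiag V (\<lambda>j. h j - w j)"
    unfolding udiag_diff[symmetric] h[symmetric] by simp
  ultimately have "spectral exp (\<sigma> - udiag V w + L) = (1 / \<tau>) *\<^sub>R (\<sigma> - (\<sigma> - udiag V w))"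
    by (simp add: spectral_udiag[OF V] udiag_scaleR)
  then have "(1 / \<tau>) *\<^sub>R (\<sigma> - (\<sigma> - udiag V w)) \<in> subdifferential (conjugate (\<lambda>\<rho>. QKL \<rho> \<rho>\<^sub>0)) (\<sigma> - udiag V w)"
    using subdifferential_conjugate_QKL[OF \<rho>\<^sub>0 \<rho>] by (simp add: L_def)
  then have "prox \<tau> (conjugate (\<lambda>\<rho>. QKL \<rho> \<rho>\<^sub>0)) \<sigma> = {\<sigma> - udiag V w}"
    by (rule prox_eqI[OF assms(3,4) \<rho>])
  then show ?thesis
    using subdifferential_conjugate_QKL[OF \<rho>\<^sub>0 assms(4)] W G by (simp add: L_def)
qed

end
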